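(* For 5-qubit CSX-states $$|\psi_X^{(5)}\rangle=a|00000\rangle+c\,\overbrace{|00011\rangle}+d\,\overbrace{|00101\rangle}+g\,\overbrace{|01111\rangle},\qquad a,c,d,g\in\mathbb{C},\ |a|^2+|c|^2+|d|^2+|g|^2=1,$$ the subconcurrences $s\mathcal{C}_1^{(5)}$ and $s\mathcal{C}_2^{(5)}$ have a common threshold $\tau\approx 0.418$ (rounded to three decimal places). That is: there is a real number $\tau$ with $|\tau-0.418|\le 0.0005$ such that, for each $(j,k)\in\{(1,2),(2,1)\}$, $\tau$ is the smallest real number with the property that every 5-qubit CSX-state with $s\mathcal{C}_j^{(5)}>\tau$ has $s\mathcal{C}_k^{(5)}<0$ (hence zero concurrence between parties $k$ apart).
   Context: For a bit string $i_1\dots i_n$, $\overbrace{|i_1 i_2\dots i_n\rangle}$ denotes the normalized equal-weight superposition of the distinct computational basis vectors obtained from $|i_1\dots i_n\rangle$ by cyclic permutations of the $n$ tensor factors (for each of the three five-bit strings displayed with an overbrace in the claim the orbit has 5 elements and the normalization is $1/\sqrt5$). A CSX-state is a pure state invariant under cyclic permutations of the parties which is a superposition only of computational basis elements containing an even number of 1's; for 5 qubits these are exactly the states displayed in the claim. For a two-qubit density matrix $\rho$, the subconcurrence is $s\mathcal{C}(\rho)=\lambda_1-\lambda_2-\lambda_3-\lambda_4$, where $\lambda_1\ge\lambda_2\ge\lambda_3\ge\lambda_4$ are the square roots of the eigenvalues of $\rho\tilde\rho$, with $\tilde\rho=(\sigma_y\otimes\sigma_y)\rho^*(\sigma_y\otimes\sigma_y)$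 and $\rho^*$ the entrywise complex conjugate in the computational basis; the (Wootters) concurrence is $\max\{0,s\mathcal{C}(\rho)\}$. For a cyclically symmetric 5-qubit state, $s\mathcal{C}_k^{(5)}$ ($k=1,2$) is the subconcurrence of the reduced density matrix of two parties whose labels differ by $k$ mod 5 (independent of the pair). The threshold of one of the two subconcurrences is the value above which the other subconcurrence must be negative. *)

theory Defs
  imports "Jordan_Normal_Form.Char_Poly" Complex_Main
begin

text \<open>An \<open>n\<close>-qubit vector is given by its amplitudes in the computational basis, i.e. a function
  on bit strings of length \<open>n\<close> (vanishing elsewhere). Party \<open>p\<close> holds the bit at list position \<open>p\<close>.\<close>

type_synonym qvec = "nat list \<Rightarrow> complex"

definition bitstrings :: "nat \<Rightarrow> nat list set" where
  "bitstrings n = {s. length s = n \<and> set s \<subseteq> {0, 1}}"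

definition ket :: "nat list \<Rightarrow> qvec" where
  "ket s = (\<lambda>t. if t = s then 1 else 0)"

definition cyclic_orbit :: "nat list \<Rightarrow> nat list set" where
  "cyclic_orbit s = {rotate m s | m. True}"

definition overbrace_ket :: "nat list \<Rightarrow> qvec" where
  "overbrace_ket s =
     (\<lambda>t. (\<Sum>u\<in>cyclic_orbit s. ket u t) / complex_of_real (sqrt (real (card (cyclic_orbit s)))))"

definition csx5 :: "complex \<Rightarrow> complex \<Rightarrow> complex \<Rightarrow> complex \<Rightarrow> qvec" where
  "csx5 a c d g = (\<lambda>t. a * ket [0,0,0,0,0] t + c * overbrace_ket [0,0,0,1,1] t
                      + d * overbrace_ket [0,0,1,0,1] t + g * overbrace_ket [0,1,1,1,1] t)"

definition CSX5 :: "qvec set" where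
  "CSX5 = {csx5 a c d g | a c d g. (cmod a)\<^sup>2 + (cmod c)\<^sup>2 + (cmod d)\<^sup>2 + (cmod g)\<^sup>2 = 1}"

text \<open>Partial trace of the projector onto \<open>\<psi>\<close> over all parties except \<open>p\<close> and \<open>q\<close>. Two-qubit
  operators are matrices in the computational basis, with \<open>|ij\<rangle>\<close> at index \<open>2 * i + j\<close>.\<close>

definition reduced2 :: "nat \<Rightarrow> qvec \<Rightarrow> nat \<Rightarrow> nat \<Rightarrow> complex mat" where
  "reduced2 n \<psi> p q = mat 4 4 (\<lambda>(x, y).
     \<Sum>s\<in>{s \<in> bitstrings n. s ! p = x div 2 \<and> s ! q = x mod 2}.
       \<psi> s * cnj (\<psi> (s[p := y div 2, q := y mod 2])))"

definition kron :: "complex mat \<Rightarrow> complex mat \<Rightarrow> complex mat" where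
  "kron A B = mat (dim_row A * dim_row B) (dim_col A * dim_col B) (\<lambda>(i, j).
     A $$ (i div dim_row B, j div dim_col B) * B $$ (i mod dim_row B, j mod dim_col B))"

definition sigma_y :: "complex mat" where
  "sigma_y = mat_of_rows_list 2 [[0, - \<i>], [\<i>, 0]]"

definition spin_flip :: "complex mat \<Rightarrow> complex mat" where
  "spin_flip \<rho> = kron sigma_y sigma_y * map_mat cnj \<rho> * kron sigma_y sigma_y"

text \<open>The eigenvalues are taken with algebraic multiplicity. For a density matrix they are
  nonnegative reals, so that \<^term>\<open>Re\<close> only changes the type.\<close>

definition wootters_lambdas :: "complex mat \<Rightarrow> real list" where
  "wootters_lambdas \<rho> = rev (sorted_list_of_multiset
     (image_mset (\<lambda>z. sqrt (Re z)) (proots (char_poly (\<rho> * spin_flip \<rho>)))))"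

definition subconcurrence :: "complex mat \<Rightarrow> real" where
  "subconcurrence \<rho> = (let l = wootters_lambdas \<rho> in l ! 0 - l ! 1 - l ! 2 - l ! 3)"

definition concurrence :: "complex mat \<Rightarrow> real" where
  "concurrence \<rho> = max 0 (subconcurrence \<rho>)"

text \<open>The representative pair is \<open>(0, k)\<close>; see \<open>reduced2_shift\<close> for the independence of the pair.\<close>

definition sC5 :: "nat \<Rightarrow> qvec \<Rightarrow> real" where
  "sC5 k \<psi> = subconcurrence (reduced2 5 \<psi> 0 k)"

definition C5 :: "nat \<Rightarrow> qvec \<Rightarrow> real" where
  "C5 k \<psi> = concurrence (reduced2 5 \<psi> 0 k)"

lemma rotate_bitstrings: "rotate m s \<in> bitstrings n \<longleftrightarrow> s \<in> bitstrings n"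
  by (simp add: bitstrings_def)

lemma mod5_cancel:
  assumes "p < 5" "i < 5" "k < (5::nat)"
  shows "(p + i) mod 5 = (p + k) mod 5 \<longleftrightarrow> i = k"
proof -
  have "p \<in> {0,1,2,3,4}" "i \<in> {0,1,2,3,4}" "k \<in> {0,1,2,3,4}" using assms by auto
  then show ?thesis by (elim insertE emptyE; simp)
qed

lemma rotate_inv5:
  assumes "p < 5" "length s = 5"
  shows "rotate p (rotate (5 - p) s) = s" "rotate (5 - p) (rotate p s) = s"
  using assms by (simp_all add: rotate_rotate)

lemma reduced2_shift:
  assumes cyc: "\<And>s. \<psi> (rotate1 s) = \<psi> s" and p: "p < 5" and k: "k < 5"
  shows "reduced2 5 \<psi> p ((p + k) mod 5) = reduced2 5 \<psi> 0 k"
proof -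
  have cycm: "\<psi> (rotate m s) = \<psi> s" for m s
    by (induction m) (simp_all add: cyc)
  have nth: "rotate p s ! i = s ! ((p + i) mod 5)" if "s \<in> bitstrings 5" "i < 5" for s i
    using that by (simp add: bitstrings_def nth_rotate)
  have upd: "rotate p (s[p := u, (p + k) mod 5 := v]) = (rotate p s)[0 := u, k := v]"
    if "s \<in> bitstrings 5" for s u v
  proof (rule nth_equalityI)
    fix i assume "i < length (rotate p (s[p := u, (p + k) mod 5 := v]))"
    with that have i: "i < 5" and l: "length s = 5" by (auto simp: bitstrings_def)
    have e1: "(p + i) mod 5 = (p + k) mod 5 \<longleftrightarrow> i = k"
      using mod5_cancel[OF p i k] .
    have e2: "(p + i) mod 5 = p \<longleftrightarrow> i = 0"
      using mod5_cancel[OF p i, of 0] p by simp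
    show "rotate p (s[p := u, (p + k) mod 5 := v]) ! i = (rotate p s)[0 := u, k := v] ! i"
      using i l p k e1 e2 by (auto simp: nth_rotate nth_list_update)
  qed simp
  have "(\<Sum>s\<in>{s \<in> bitstrings 5. s ! p = x div 2 \<and> s ! ((p + k) mod 5) = x mod 2}.
          \<psi> s * cnj (\<psi> (s[p := y div 2, (p + k) mod 5 := y mod 2])))
      = (\<Sum>s\<in>{s \<in> bitstrings 5. s ! 0 = x div 2 \<and> s ! k = x mod 2}.
          \<psi> s * cnj (\<psi> (s[0 := y div 2, k := y mod 2])))" for x y
  proof (rule sum.reindex_bij_witness[where i = "rotate (5 - p)" and j = "rotate p"], goal_cases)
    case (1 s) then show ?case using rotate_inv5(2)[OF p, of s] by (auto simp: bitstrings_def)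
  next
    case (2 s) then show ?case using nth[of s 0] nth[of s k] p k by (simp add: rotate_bitstrings)
  next
    case (3 s) then show ?case using rotate_inv5(1)[OF p, of s] by (auto simp: bitstrings_def)
  next
    case (4 s)
    let ?t = "rotate (5 - p) s"
    have t: "?t \<in> bitstrings 5" "rotate p ?t = s"
      using 4 rotate_inv5(1)[OF p, of s] by (auto simp: bitstrings_def)
    show ?case using 4 nth[OF t(1), of 0] nth[OF t(1), of k] t p k by simp
  next
    case (5 s) then show ?case by (simp add: cycm upd[symmetric])
  qed
  then show ?thesis by (simp add: reduced2_def)
qed

lemma cyclic_orbit_eq:
  assumes "length s = 5"
  shows "cyclic_orbit s = (\<lambda>m. rotate m s) ` {0,1,2,3,4}"
proof -
  have "rotate m s \<in> (\<lambda>m. rotate m s) ` {0,1,2,3,4}" for m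
  proof -
    have "rotate m s = rotate (m mod 5) s" using assms by (metis rotate_conv_mod)
    moreover have "m mod 5 < 5" by simp
    then have "m mod 5 \<in> {0,1,2,3,4}" unfolding insert_iff empty_iff by linarith
    ultimately show ?thesis by (rule image_eqI)
  qed
  then show ?thesis unfolding cyclic_orbit_def by blast
qed

lemma cyclic_orbits:
  "cyclic_orbit [0,0,0,1,1] = {[0,0,0,1,1],[0,0,1,1,0],[0,1,1,0,0],[1,1,0,0,0],[1,0,0,0,1]}"
  "cyclic_orbit [0,0,1,0,1] = {[0,0,1,0,1],[0,1,0,1,0],[1,0,1,0,0],[0,1,0,0,1],[1,0,0,1,0]}"
  "cyclic_orbit [0,1,1,1,1] = {[0,1,1,1,1],[1,1,1,1,0],[1,1,1,0,1],[1,1,0,1,1],[1,0,1,1,1]}"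
  by (simp_all add: cyclic_orbit_eq rotate_def eval_nat_numeral)

lemma card_cyclic_orbits:
  "card (cyclic_orbit [0,0,0,1,1]) = 5"
  "card (cyclic_orbit [0,0,1,0,1]) = 5"
  "card (cyclic_orbit [0,1,1,1,1]) = 5"
  unfolding cyclic_orbits by simp_all

lemma overbrace_ket_apply:
  assumes "finite (cyclic_orbit s)"
  shows "overbrace_ket s t =
    (if t \<in> cyclic_orbit s then 1 / complex_of_real (sqrt (real (card (cyclic_orbit s)))) else 0)"
proof -
  have "(\<Sum>u\<in>cyclic_orbit s. ket u t) = (if t \<in> cyclic_orbit s then 1 else 0)"
    unfolding ket_def using assms by (rule sum.delta')
  then show ?thesis by (simp add: overbrace_ket_def)
qed

lemma finite_cyclic_orbits:
  "finite (cyclic_orbit [0,0,0,1,1])"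
  "finite (cyclic_orbit [0,0,1,0,1])"
  "finite (cyclic_orbit [0,1,1,1,1])"
  unfolding cyclic_orbits by simp_all

lemma overbrace_ket_values:
  "overbrace_ket [0,0,0,1,1] t = (if t \<in> {[0,0,0,1,1],[0,0,1,1,0],[0,1,1,0,0],[1,1,0,0,0],[1,0,0,0,1]}
      then 1 / complex_of_real (sqrt 5) else 0)"
  "overbrace_ket [0,0,1,0,1] t = (if t \<in> {[0,0,1,0,1],[0,1,0,1,0],[1,0,1,0,0],[0,1,0,0,1],[1,0,0,1,0]}
      then 1 / complex_of_real (sqrt 5) else 0)"
  "overbrace_ket [0,1,1,1,1] t = (if t \<in> {[0,1,1,1,1],[1,1,1,1,0],[1,1,1,0,1],[1,1,0,1,1],[1,0,1,1,1]}
      then 1 / complex_of_real (sqrt 5) else 0)"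
  unfolding overbrace_ket_apply[OF finite_cyclic_orbits(1)]
    overbrace_ket_apply[OF finite_cyclic_orbits(2)]
    overbrace_ket_apply[OF finite_cyclic_orbits(3)] card_cyclic_orbits of_nat_numeral
  unfolding cyclic_orbits
  by (rule refl)+

lemma bitstrings5: "bitstrings 5 = {[a,b,c,d,e] | a b c d e.
   a \<in> {0,1} \<and> b \<in> {0,1} \<and> c \<in> {0,1} \<and> d \<in> {0,1} \<and> e \<in> {0,1}}"
  by (auto simp: bitstrings_def length_Suc_conv numeral_eq_Suc)

lemma bitstrings5_explicit: "bitstrings 5 = set (List.n_lists 5 [0,1])"
  by (auto simp: bitstrings_def set_n_lists)

lemma csx5_values:
  "csx5 a c d g t = (if t = [0,0,0,0,0] then a
    else if t \<in> {[0,0,0,1,1],[0,0,1,1,0],[0,1,1,0,0],[1,1,0,0,0],[1,0,0,0,1]} then c / complex_of_real (sqrt 5)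
    else if t \<in> {[0,0,1,0,1],[0,1,0,1,0],[1,0,1,0,0],[0,1,0,0,1],[1,0,0,1,0]} then d / complex_of_real (sqrt 5)
    else if t \<in> {[0,1,1,1,1],[1,1,1,1,0],[1,1,1,0,1],[1,1,0,1,1],[1,0,1,1,1]} then g / complex_of_real (sqrt 5)
    else 0)"
  unfolding csx5_def overbrace_ket_values ket_def by auto

lemma csx5_norm:
  "(\<Sum>s\<in>bitstrings 5. (cmod (csx5 a c d g s))\<^sup>2) =
     (cmod a)\<^sup>2 + (cmod c)\<^sup>2 + (cmod d)\<^sup>2 + (cmod g)\<^sup>2"
proof -
  have "bitstrings 5 = set (List.n_lists 5 [0,1])" by (rule bitstrings5_explicit)
  then show ?thesis
    by (simp add: numeral_eq_Suc csx5_values norm_divide power_divide)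
qed

lemma csx5_supp: "\<forall>s. s \<notin> bitstrings 5 \<longrightarrow> csx5 a c d g s = 0"
  by (auto simp: csx5_values bitstrings_def)

lemma csx5_even: "\<forall>s. odd (sum_list s) \<longrightarrow> csx5 a c d g s = 0"
  by (auto simp: csx5_values)

lemma csx5_mem:
  assumes "(\<Sum>s\<in>bitstrings 5. (cmod (csx5 a c d g s))\<^sup>2) = 1"
  shows "csx5 a c d g \<in> CSX5"
  unfolding CSX5_def mem_Collect_eq
  by (rule exI[of _ a], rule exI[of _ c], rule exI[of _ d], rule exI[of _ g],
      rule conjI, rule refl, rule assms[unfolded csx5_norm])

text \<open>Invariance under cyclic permutations and evenness characterise the displayed family.\<close>

lemma CSX5_iff:
  "\<psi> \<in> CSX5 \<longleftrightarrow>
     (\<forall>s. s \<notin> bitstrings 5 \<longrightarrow> \<psi> s = 0) \<and>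
     (\<Sum>s\<in>bitstrings 5. (cmod (\<psi> s))\<^sup>2) = 1 \<and>
     (\<forall>s. \<psi> (rotate1 s) = \<psi> s) \<and>
     (\<forall>s. odd (sum_list s) \<longrightarrow> \<psi> s = 0)"
  (is "?L \<longleftrightarrow> ?supp \<and> ?nrm \<and> ?cyc \<and> ?even")
proof
  assume ?L
  then obtain a c d g where \<psi>: "\<psi> = csx5 a c d g"
    and n: "(cmod a)\<^sup>2 + (cmod c)\<^sup>2 + (cmod d)\<^sup>2 + (cmod g)\<^sup>2 = 1"
    by (auto simp: CSX5_def)
  have supp: ?supp unfolding \<psi> by (rule csx5_supp)
  have ?even unfolding \<psi> by (rule csx5_even)
  moreover have ?cyc
  proof
    fix s
    show "\<psi> (rotate1 s) = \<psi> s"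
    proof (cases "s \<in> bitstrings 5")
      case True
      then obtain a b c d e where "s = [a,b,c,d,e]"
        "a \<in> {0,1}" "b \<in> {0,1}" "c \<in> {0,1}" "d \<in> {0,1}" "e \<in> {0,1}"
        unfolding bitstrings5 by blast
      then show ?thesis unfolding \<psi> by (elim insertE emptyE; simp add: csx5_values)
    next
      case False
      then have "rotate1 s \<notin> bitstrings 5" by (simp add: bitstrings_def)
      with False supp show ?thesis by simp
    qed
  qed
  ultimately show "?supp \<and> ?nrm \<and> ?cyc \<and> ?even"
    using supp n by (simp add: \<psi> csx5_norm)
next
  assume R: "?supp \<and> ?nrm \<and> ?cyc \<and> ?even"
  note supp = R[THEN conjunct1]
  note nrm = R[THEN conjunct2, THEN conjunct1]
  note cyc1 = R[THEN conjunct2, THEN conjunct2, THEN conjunct1]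
  note evn = R[THEN conjunct2, THEN conjunct2, THEN conjunct2]
  define r where "r = complex_of_real (sqrt 5)"
  have r: "r \<noteq> 0" by (simp add: r_def)
  define \<phi> where "\<phi> = csx5 (\<psi> [0,0,0,0,0]) (r * \<psi> [0,0,0,1,1]) (r * \<psi> [0,0,1,0,1]) (r * \<psi> [0,1,1,1,1])"
  have cyc: "\<psi> [b,c,d,e,a] = \<psi> [a,b,c,d,e]" for a b c d e
  proof -
    have "\<psi> (rotate1 [a,b,c,d,e]) = \<psi> [a,b,c,d,e]" using cyc1 by (rule spec)
    then show ?thesis by simp
  qed
  have "\<psi> s = \<phi> s" for s
  proof (cases "s \<in> bitstrings 5")
    case False
    then have "\<psi> s = 0" using supp by blast
    moreover have "\<phi> s = 0" using False unfolding \<phi>_def by (rule csx5_supp[rule_format])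
    ultimately show ?thesis by simp
  next
    case True
    show ?thesis
    proof (cases "odd (sum_list s)")
      case True
      then have "\<psi> s = 0" using evn by blast
      moreover have "\<phi> s = 0" using True unfolding \<phi>_def by (rule csx5_even[rule_format])
      ultimately show ?thesis by simp
    next
      case False
      note z1 = cyc[of 0 0 0 1 1]
      note z2 = trans[OF cyc[of 0 0 1 1 0] z1]
      note z3 = trans[OF cyc[of 0 1 1 0 0] z2]
      note z4 = trans[OF cyc[of 1 1 0 0 0] z3]
      note z5 = cyc[of 0 0 1 0 1]
      note z6 = trans[OF cyc[of 0 1 0 1 0] z5]
      note z7 = trans[OF cyc[of 1 0 1 0 0] z6]
      note z8 = trans[OF cyc[of 0 1 0 0 1] z7]
      note z9 = cyc[of 0 1 1 1 1]
      note z10 = trans[OF cyc[of 1 1 1 1 0] z9]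
      note z11 = trans[OF cyc[of 1 1 1 0 1] z10]
      note z12 = trans[OF cyc[of 1 1 0 1 1] z11]
      note z = z1 z2 z3 z4 z5 z6 z7 z8 z9 z10 z11 z12
      obtain a b c d e where s: "s = [a,b,c,d,e]"
        "a \<in> {0,1}" "b \<in> {0,1}" "c \<in> {0,1}" "d \<in> {0,1}" "e \<in> {0,1}"
        using True unfolding bitstrings5 by blast
      show ?thesis using s(2-) False z r unfolding \<phi>_def s(1)
        by (elim insertE emptyE; simp add: csx5_values flip: r_def)
    qed
  qed
  then have \<psi>: "\<psi> = \<phi>" by (simp add: fun_eq_iff)
  have "\<phi> \<in> CSX5" using nrm[unfolded \<psi>] unfolding \<phi>_def by (rule csx5_mem)
  then show ?L by (simp only: \<psi>)
qed

end

theory Submission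
  imports Defs
begin

text \<open>Both reduced states are X-shaped, with Wootters values \<open>sqrt(\<rho>\<^sub>0\<^sub>0 \<rho>\<^sub>3\<^sub>3) \<plusminus> \<bar>\<rho>\<^sub>0\<^sub>3\<bar>\<close> and
  \<open>\<rho>\<^sub>1\<^sub>1 \<plusminus> \<bar>\<rho>\<^sub>1\<^sub>2\<bar>\<close>, so the subconcurrence is twice the larger of a corner term
  \<open>\<bar>\<rho>\<^sub>0\<^sub>3\<bar> - \<rho>\<^sub>1\<^sub>1\<close> and an inner term \<open>\<bar>\<rho>\<^sub>1\<^sub>2\<bar> - sqrt(\<rho>\<^sub>0\<^sub>0 \<rho>\<^sub>3\<^sub>3)\<close>. Exchanging \<open>c\<close> and \<open>d\<close> exchanges
  distances 1 and 2, whence the two thresholds agree: both are the supremum of the first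
  subconcurrence over the states on which the second is nonnegative. The corner term is a
  quadratic form in the moduli of the amplitudes, so its bounds reduce to positive
  semidefiniteness. The extremal states have \<open>a = g = 0\<close>, with inner terms on both sides; there the
  constraint becomes \<open>t\<^sup>4 + 4t\<^sup>3 + 3t\<^sup>2 \<ge> 2\<close> for \<open>t = \<bar>c\<bar>/\<bar>d\<bar>\<close>, and the inner term decreases with \<open>t\<close>
  beyond the root \<open>t \<approx> 0.59155\<close>.\<close>

section \<open>Determinants and characteristic polynomials of X-shaped matrices\<close>

lemma det_2:
  assumes "A \<in> carrier_mat 2 2"
  shows "det A = A $$ (0,0) * A $$ (1,1) - A $$ (0,1) * A $$ (1,0)"
  using assms
  by (simp add: laplace_expansion_row[OF assms, of 0] cofactor_def numeral_2_eq_2 det_single mat_delete_def)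

lemma det_3:
  assumes "A \<in> carrier_mat 3 3"
  shows "det A = A $$ (0,0) * (A $$ (1,1) * A $$ (2,2) - A $$ (1,2) * A $$ (2,1))
     - A $$ (0,1) * (A $$ (1,0) * A $$ (2,2) - A $$ (1,2) * A $$ (2,0))
     + A $$ (0,2) * (A $$ (1,0) * A $$ (2,1) - A $$ (1,1) * A $$ (2,0))"
proof -
  have m: "mat_delete A i j \<in> carrier_mat 2 2" for i j using assms by (auto simp: mat_delete_def)
  show ?thesis
    unfolding laplace_expansion_row[OF assms, of 0, simplified] cofactor_def det_2[OF m]
    using assms by (simp add: mat_delete_def lessThan_nat_numeral lessThan_Suc numeral_2_eq_2 algebra_simps)
qed

text \<open>X-states decompose into a block on \<open>|00>\<close>, \<open>|11>\<close> and one on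
  \<open>|01>\<close>, \<open>|10>\<close>. The four off-diagonal entries are independent, so that
  products and characteristic matrices keep this shape.\<close>

definition x_mat :: "'a \<Rightarrow> 'a \<Rightarrow> 'a \<Rightarrow> 'a \<Rightarrow> 'a \<Rightarrow> 'a \<Rightarrow> 'a \<Rightarrow> 'a \<Rightarrow> 'a::zero mat" where
  "x_mat p q r s z w w' z' = mat_of_rows_list 4 [[p, 0, 0, z], [0, q, w, 0], [0, w', r, 0], [z', 0, 0, s]]"

lemma x_mat_carrier [simp]: "x_mat p q r s z w w' z' \<in> carrier_mat 4 4"
  "dim_row (x_mat p q r s z w w' z') = 4" "dim_col (x_mat p q r s z w w' z') = 4"
  by (auto simp: x_mat_def mat_of_rows_list_def)

lemma less_4_iff: "i < 4 \<longleftrightarrow> i \<in> {0, 1, 2, 3::nat}" by auto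

lemma mat_4_eqI:
  assumes "A \<in> carrier_mat 4 4" "B \<in> carrier_mat 4 4"
    "\<And>i j. i \<in> {0,1,2,3} \<Longrightarrow> j \<in> {0,1,2,3} \<Longrightarrow> A $$ (i,j) = B $$ (i,j)"
  shows "A = B"
  using assms by (intro eq_matI) (auto simp: less_4_iff)

lemma det_x_mat: "det (x_mat p q r s z w w' z') = (p * s - z * z') * (q * r - w * w')" for p :: "'a::comm_ring_1"
proof -
  let ?A = "x_mat p q r s z w w' z'"
  have m: "mat_delete ?A i j \<in> carrier_mat 3 3" for i j by (auto simp: mat_delete_def)
  show ?thesis
    unfolding laplace_expansion_row[of ?A 4 0, simplified] cofactor_def det_3[OF m]
    by (simp add: mat_delete_def x_mat_def mat_of_rows_list_def lessThan_nat_numeral lessThan_Suc eval_nat_numeral algebra_simps)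
qed

text \<open>The characteristic matrix is X-shaped over the polynomial ring, so
  \<open>det_x_mat\<close> applies there; this is why both lemmas are stated over commutative
  rings.\<close>

lemma char_poly_x_mat:
  "char_poly (x_mat p q r s z w w' z')
    = ([:-p, 1:] * [:-s, 1:] - [:z * z':]) * ([:-q, 1:] * [:-r, 1:] - [:w * w':])" for p :: "'a::comm_ring_1"
proof -
  have "char_poly_matrix (x_mat p q r s z w w' z')
     = x_mat [:-p, 1:] [:-q, 1:] [:-r, 1:] [:-s, 1:] [:-z:] [:-w:] [:-w':] [:-z':]"
    by (rule mat_4_eqI) (auto simp: char_poly_matrix_def x_mat_def mat_of_rows_list_def)
  then show ?thesis by (simp add: char_poly_def det_x_mat mult.commute)
qed

section \<open>Spin flip and subconcurrence of X-shaped matrices\<close>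

lemma kron_sigma_y: "kron sigma_y sigma_y = x_mat 0 0 0 0 (-1) 1 1 (-1)"
proof -
  have "dim_row sigma_y = 2" "dim_col sigma_y = 2"
    "sigma_y $$ (0,0) = 0" "sigma_y $$ (0,1) = -\<i>" "sigma_y $$ (1,0) = \<i>" "sigma_y $$ (1,1) = 0"
    by (auto simp: sigma_y_def mat_of_rows_list_def)
  note this[unfolded One_nat_def, simp]
  show ?thesis
  proof (rule mat_4_eqI)
    show "kron sigma_y sigma_y \<in> carrier_mat 4 4" by (auto simp: kron_def)
    show "kron sigma_y sigma_y $$ (i, j) = x_mat 0 0 0 0 (-1) 1 1 (-1) $$ (i, j)"
      if "i \<in> {0, 1, 2, 3}" "j \<in> {0, 1, 2, 3}" for i j
      using that by (elim insertE emptyE) (simp_all add: kron_def x_mat_def mat_of_rows_list_def)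
  qed simp
qed

lemma x_mat_mult:
  "x_mat p q r s z w w' z' * x_mat p2 q2 r2 s2 z2 w2 w2' z2' =
   x_mat (p * p2 + z * z2') (q * q2 + w * w2') (r * r2 + w' * w2) (s * s2 + z' * z2)
     (p * z2 + z * s2) (q * w2 + w * r2) (w' * q2 + r * w2') (z' * p2 + s * z2')" for p :: "'a::comm_ring_1"
  by (rule mat_4_eqI) (auto simp: x_mat_def mat_of_rows_list_def scalar_prod_def atLeast0_lessThan_Suc eval_nat_numeral)

lemma spin_flip_x_mat:
  "spin_flip (x_mat p q r s z w w' z') = x_mat (cnj s) (cnj r) (cnj q) (cnj p) (cnj z') (cnj w') (cnj w) (cnj z)"
proof -
  have c: "map_mat cnj (x_mat p q r s z w w' z')
      = x_mat (cnj p) (cnj q) (cnj r) (cnj s) (cnj z) (cnj w) (cnj w') (cnj z')"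
    by (rule mat_4_eqI) (auto simp: x_mat_def mat_of_rows_list_def)
  show ?thesis
    unfolding spin_flip_def kron_sigma_y c x_mat_mult by simp
qed

lemma proots_quadratic_product:
  fixes u v u' v' :: "'a::idom"
  shows "proots (([:-u, 1:] * [:-v, 1:]) * ([:-u', 1:] * [:-v', 1:])) = {#u, v, u', v'#}"
proof -
  have "[:-a, 1:] * [:-b, 1:] \<noteq> 0" for a b :: 'a by (simp only: mult_eq_0_iff) simp
  then have "proots (([:-u, 1:] * [:-v, 1:]) * ([:-u', 1:] * [:-v', 1:]))
    = (proots [:-u, 1:] + proots [:-v, 1:]) + (proots [:-u', 1:] + proots [:-v', 1:])"
    by (simp only: proots_mult mult_eq_0_iff de_Morgan_disj simp_thms)
  then show ?thesis by simp
qed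

text \<open>The largest value minus the others is twice the largest minus the total, so the order of
  the four values never has to be determined.\<close>

lemma descending_four:
  fixes a b c d :: real
  defines "l \<equiv> rev (sorted_list_of_multiset {#a, b, c, d#})"
  shows "l ! 0 - l ! 1 - l ! 2 - l ! 3 = 2 * Max {a, b, c, d} - (a + b + c + d)"
proof -
  define xs where "xs = sorted_list_of_multiset {#a, b, c, d#}"
  have m: "mset xs = {#a, b, c, d#}" and srt: "sorted xs"
    by (simp_all add: xs_def del: sorted_list_of_multiset_insert)
  have "length xs = 4" using arg_cong[OF m, of size] by simp
  then obtain x0 x1 x2 x3 where xs: "xs = [x0, x1, x2, x3]"
    by (auto simp: length_Suc_conv eval_nat_numeral)
  have "{a, b, c, d} = set xs" using arg_cong[OF m, of set_mset] by simp
  then have "Max {a, b, c, d} = x3" using srt by (auto simp: xs intro!: Max_eqI)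
  moreover have "a + b + c + d = x0 + x1 + x2 + x3"
    using arg_cong[OF m, of sum_mset] by (simp add: xs)
  ultimately show ?thesis unfolding l_def xs_def[symmetric] xs by (simp add: eval_nat_numeral)
qed

text \<open>Each block of \<open>\<rho> * spin_flip \<rho>\<close> has two squares as eigenvalues,
  \<open>(s + cmod z)^2\<close> and \<open>(s - cmod z)^2\<close> or \<open>(q + cmod w)^2\<close>
  and \<open>(q - cmod w)^2\<close>. Positivity of the blocks of \<open>\<rho>\<close> makes all
  four bases nonnegative, so the square roots return them without absolute values.\<close>

lemma subconcurrence_x_mat:
  fixes p q r :: real and z w :: complex
  assumes nonneg: "0 \<le> p" "0 \<le> r" and z: "cmod z \<le> sqrt (p * r)" and w: "cmod w \<le> q"
  shows "subconcurrence (x_mat (of_real p) (of_real q) (of_real q) (of_real r) z w (cnj w) (cnj z))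
    = 2 * max (cmod z - q) (cmod w - sqrt (p * r))"
proof -
  define s where "s = sqrt (p * r)"
  have s: "s\<^sup>2 = p * r" using nonneg by (simp add: s_def)
  define \<rho> where "\<rho> = x_mat (of_real p) (of_real q) (of_real q) (of_real r) z w (cnj w) (cnj z)"
  let ?sq = "\<lambda>x::real. complex_of_real (x\<^sup>2)"
  \<comment> \<open>Monic quadratics agree once the sums and products of their roots agree, so only
    the trace and the determinant of each block are compared.\<close>
  have q2: "[:-a, 1:] * [:-b, 1:] - [:k:] = [:-u, 1:] * [:-v, 1:]"
    if "a + b = u + v" "a * b - k = u * v" for a b k u v :: complex
    using that by (simp add: algebra_simps)
  have sC: "complex_of_real s ^ 2 = of_real p * of_real r"
    using s by (metis of_real_mult of_real_power)
  have zz: "z * cnj z = of_real (cmod z) ^ 2" "w * cnj w = of_real (cmod w) ^ 2"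
    using complex_norm_square[of z] complex_norm_square[of w] by (simp_all only: of_real_power)
  have det2: "(a * b + x * y) * (b * a + y * x) - (a * x + x * a) * (y * b + b * y) = (S + Z)\<^sup>2 * (S - Z)\<^sup>2"
    if "S\<^sup>2 = a * b" "x * y = Z\<^sup>2" for a b x y S Z :: complex
  proof -
    have "(S + Z)\<^sup>2 * (S - Z)\<^sup>2 = (S\<^sup>2 - Z\<^sup>2)\<^sup>2"
      by (simp add: power2_eq_square algebra_simps)
    then show ?thesis unfolding that(1) that(2)[symmetric] by (simp add: power2_eq_square algebra_simps)
  qed
  have "char_poly (\<rho> * spin_flip \<rho>) =
     ([:- ?sq (s + cmod z), 1:] * [:- ?sq (s - cmod z), 1:]) *
     ([:- ?sq (q + cmod w), 1:] * [:- ?sq (q - cmod w), 1:])"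
    unfolding \<rho>_def spin_flip_x_mat x_mat_mult char_poly_x_mat
    apply (intro arg_cong2[of _ _ _ _ "(*)"] q2)
    subgoal using sC zz by (simp add: power2_eq_square algebra_simps)
    subgoal using det2[OF sC zz(1)] by simp
    subgoal using zz by (simp add: power2_eq_square algebra_simps)
    subgoal using det2[OF power2_eq_square zz(2), of "of_real q"] by (simp add: ac_simps)
    done
  then have ch: "proots (char_poly (\<rho> * spin_flip \<rho>)) =
      {#?sq (s + cmod z), ?sq (s - cmod z), ?sq (q + cmod w), ?sq (q - cmod w)#}"
    by (simp only: proots_quadratic_product)
  have "0 \<le> s + cmod z" "0 \<le> s - cmod z" "0 \<le> q + cmod w" "0 \<le> q - cmod w"
    using z w norm_ge_zero[of z] norm_ge_zero[of w] unfolding s_def by argo+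
  then have "wootters_lambdas \<rho> =
      rev (sorted_list_of_multiset {#s + cmod z, s - cmod z, q + cmod w, q - cmod w#})"
    unfolding wootters_lambdas_def ch
    by (simp del: sorted_list_of_multiset_insert of_real_add of_real_diff of_real_power)
  then have "subconcurrence \<rho> = 2 * Max {s + cmod z, s - cmod z, q + cmod w, q - cmod w} - (2 * s + 2 * q)"
    by (simp only: subconcurrence_def Let_def descending_four)
  moreover have "Max {s + cmod z, s - cmod z, q + cmod w, q - cmod w} = max (s + cmod z) (q + cmod w)"
    using norm_ge_zero[of z] norm_ge_zero[of w] by (auto simp: max_def simp del: norm_ge_zero)
  ultimately show ?thesis by (simp add: \<rho>_def s_def max_def)
qed

section \<open>Real inequalities behind the upper bound\<close>

text \<open>The variables \<open>c\<close>, \<open>d\<close>, \<open>g\<close> stand for moduli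
  divided by \<open>sqrt 5\<close>, so \<open>A^2 + 5 * (c^2 + d^2 + g^2)\<close> is the squared
  norm. The constant is half of 0.4185, the upper end of the tolerance, because the subconcurrence
  is twice the corner term.\<close>

lemma corner_bound:
  fixes A c d g :: real
  shows "A * c + (2 * c + d) * g - (c\<^sup>2 + 2 * d\<^sup>2 + g\<^sup>2) \<le> 837/4000 * (A\<^sup>2 + 5 * (c\<^sup>2 + d\<^sup>2 + g\<^sup>2))"
proof -
  \<comment> \<open>The coefficients come from an \<open>LDL\<^sup>T\<close> factorisation of the right-hand side minus the left.\<close>
  have "0 \<le> (2437/800)*(d - 400/2437*g)\<^sup>2 + (3829369/1949600)*(g - 1949600/3829369*c)\<^sup>2
    + (837/4000)*(A - 2000/837*c)\<^sup>2 + (877935333361/2564145482400)*c\<^sup>2"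
    by simp
  also have "\<dots> = 837/4000 * (A\<^sup>2 + 5 * (c\<^sup>2 + d\<^sup>2 + g\<^sup>2)) - (A * c + (2 * c + d) * g - (c\<^sup>2 + 2 * d\<^sup>2 + g\<^sup>2))"
    by (simp add: power2_eq_square field_simps)
  finally show ?thesis by simp
qed

text \<open>\<open>F\<close> says that the corner term at the other distance is nonnegative. A lower
  bound of the square root by a product of linear forms makes the claim quadratic.\<close>

lemma inner_bound_if_corner_nonneg:
  fixes A c d g :: real
  assumes nn: "0 \<le> A" "0 \<le> c" "0 \<le> d" "0 \<le> g"
    and F: "0 \<le> A * d + (2 * d + c) * g - (d\<^sup>2 + 2 * c\<^sup>2 + g\<^sup>2)"
  shows "2 * c * d + d\<^sup>2 + g\<^sup>2 - sqrt ((A\<^sup>2 + 2 * c\<^sup>2 + d\<^sup>2) * (c\<^sup>2 + 3 * g\<^sup>2))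
    \<le> 837/4000 * (A\<^sup>2 + 5 * (c\<^sup>2 + d\<^sup>2 + g\<^sup>2))"
proof -
  \<comment> \<open>For the linear forms here and in \<open>2\<close>, Cauchy's inequality gives the
    factors 98/100 and 81/100 + 49/300, both below 1.\<close>
  have 1: "(7/10 * (A + d))\<^sup>2 \<le> A\<^sup>2 + 2 * c\<^sup>2 + d\<^sup>2"
  proof -
    have "0 \<le> 49/100 * (A - d)\<^sup>2 + 1/50 * A\<^sup>2 + 1/50 * d\<^sup>2 + 2 * c\<^sup>2" by simp
    then show ?thesis by (simp add: power2_eq_square field_simps)
  qed
  have 2: "(9/10 * c + 7/10 * g)\<^sup>2 \<le> c\<^sup>2 + 3 * g\<^sup>2"
  proof -
    have "0 \<le> 19/100 * (c - 63/19 * g)\<^sup>2 + (251/100 - 3969/1900) * g\<^sup>2" by simp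
    then show ?thesis by (simp add: power2_eq_square field_simps)
  qed
  have "7/10 * (A + d) * (9/10 * c + 7/10 * g) \<le> sqrt ((A\<^sup>2 + 2 * c\<^sup>2 + d\<^sup>2) * (c\<^sup>2 + 3 * g\<^sup>2))"
    using mult_mono[OF 1 2] nn unfolding power_mult_distrib[symmetric] by (intro real_le_rsqrt) simp
  \<comment> \<open>With the square root replaced by the product of linear forms above, and \<open>7/10\<close> times
    hypothesis \<open>F\<close> added, the difference of the two sides is a positive definite quadratic form.\<close>
  moreover have "0 \<le> (1957/800)*(c - 280/1957*g - 548/1957*d + 252/1957*A)\<^sup>2
     + (1089929/1565600)*(g - 865788/1089929*d + 454132/1089929*A)\<^sup>2
     + (100407133/871943200)*(d - 27358520/100407133*A)\<^sup>2 + (15775107121/401628532000)*A\<^sup>2"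
    by simp
  moreover have "(1957/800)*(c - 280/1957*g - 548/1957*d + 252/1957*A)\<^sup>2
     + (1089929/1565600)*(g - 865788/1089929*d + 454132/1089929*A)\<^sup>2
     + (100407133/871943200)*(d - 27358520/100407133*A)\<^sup>2 + (15775107121/401628532000)*A\<^sup>2
     = 837/4000 * (A\<^sup>2 + 5 * (c\<^sup>2 + d\<^sup>2 + g\<^sup>2)) - (2 * c * d + d\<^sup>2 + g\<^sup>2)
       + 7/10 * (A + d) * (9/10 * c + 7/10 * g)
       - 7/10 * (A * d + (2 * d + c) * g - (d\<^sup>2 + 2 * c\<^sup>2 + g\<^sup>2))"
    by (simp add: power2_eq_square field_simps)
  ultimately show ?thesis using F by argo
qed

text \<open>The extremal case, with \<open>y\<close> in the role of \<open>g^2\<close>;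
  \<open>G\<close> says that the inner term at the other distance is nonnegative. A violation of the
  bound makes \<open>y\<close> small, \<open>G\<close> then bounds \<open>c / d\<close> from below,
  and at such ratios the inner term is too small for a violation.\<close>

lemma inner_bound_if_inner_nonneg:
  fixes A c d y :: real
  assumes nn: "0 \<le> c" "0 \<le> d" "0 \<le> y"
    and G: "sqrt ((A\<^sup>2 + 2 * d\<^sup>2 + c\<^sup>2) * (d\<^sup>2 + 3 * y)) \<le> 2 * c * d + c\<^sup>2 + y"
  shows "2 * c * d + d\<^sup>2 + y - sqrt ((A\<^sup>2 + 2 * c\<^sup>2 + d\<^sup>2) * (c\<^sup>2 + 3 * y))
    \<le> 837/4000 * (A\<^sup>2 + 5 * (c\<^sup>2 + d\<^sup>2 + y))"
proof (rule ccontr)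
  define u where "u = sqrt ((2 * c\<^sup>2 + d\<^sup>2) * (c\<^sup>2 + 3 * y))"
  assume "\<not> ?thesis"
  moreover have "u \<le> sqrt ((A\<^sup>2 + 2 * c\<^sup>2 + d\<^sup>2) * (c\<^sup>2 + 3 * y))"
    unfolding u_def using nn by (intro real_sqrt_le_mono mult_right_mono) auto
  ultimately have u: "u + 837/800 * (c\<^sup>2 + d\<^sup>2 + y) < 2 * c * d + d\<^sup>2 + y"
    using zero_le_power2[of A] unfolding distrib_left by argo
  have u0: "0 \<le> u" using nn by (simp add: u_def)
  have "0 \<le> (c - d)\<^sup>2" by simp
  then have "2 * c * d \<le> c\<^sup>2 + d\<^sup>2" by (simp add: power2_eq_square field_simps)
  then have "u < d\<^sup>2" using u nn(3) zero_le_power2[of c] zero_le_power2[of d] by argo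
  then have d: "0 < d\<^sup>2" using u0 by argo
  then have d0: "0 < d" using nn by simp
  \<comment> \<open>Keeping only \<open>d^2\<close> and \<open>3 * y\<close> from the two factors of
    \<open>u^2\<close> turns \<open>u < d^2\<close> into a bound on \<open>y\<close>.\<close>
  have "d\<^sup>2 * (3 * y) \<le> (2 * c\<^sup>2 + d\<^sup>2) * (c\<^sup>2 + 3 * y)"
    using nn by (intro mult_mono) auto
  also have "\<dots> = u\<^sup>2" using nn by (simp add: u_def)
  also have "\<dots> < (d\<^sup>2)\<^sup>2" using \<open>u < d\<^sup>2\<close> u0 by (intro power_strict_mono) auto
  finally have "d\<^sup>2 * (3 * y) < d\<^sup>2 * d\<^sup>2" by (simp only: power2_eq_square[of "d\<^sup>2"])
  then have y: "3 * y < d\<^sup>2" using d by (simp only: mult_less_cancel_left_pos)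
  have "(A\<^sup>2 + 2 * d\<^sup>2 + c\<^sup>2) * (d\<^sup>2 + 3 * y) \<le> (2 * c * d + c\<^sup>2 + y)\<^sup>2"
    using G nn by (intro sqrt_le_D) auto
  moreover have "(2 * d\<^sup>2 + c\<^sup>2) * (d\<^sup>2 + 3 * y) \<le> (A\<^sup>2 + 2 * d\<^sup>2 + c\<^sup>2) * (d\<^sup>2 + 3 * y)"
    using nn by (intro mult_right_mono) auto
  \<comment> \<open>These are the terms in \<open>y\<close> left over from squaring
    \<open>G\<close>; their sign allows \<open>y\<close> to be dropped from the quartic.\<close>
  moreover have "0 \<le> y * (2 * d\<^sup>2 - y + (2 * d - c)\<^sup>2)"
    using nn y by (intro mult_nonneg_nonneg add_nonneg_nonneg) auto
  ultimately have quartic: "0 \<le> c^4 + 4 * c^3 * d + 3 * c\<^sup>2 * d\<^sup>2 - 2 * d^4"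
    by (simp add: power2_eq_square power3_eq_cube power4_eq_xxxx field_simps)
  define t where "t = c / d"
  have c: "c = t * d" and t0: "0 \<le> t" using d0 nn by (simp_all add: t_def)
  have "c^4 + 4 * c^3 * d + 3 * c\<^sup>2 * d\<^sup>2 - 2 * d^4 = (t^4 + 4 * t^3 + 3 * t\<^sup>2 - 2) * d^4"
    by (simp add: c power2_eq_square power3_eq_cube power4_eq_xxxx field_simps)
  then have q: "0 \<le> t^4 + 4 * t^3 + 3 * t\<^sup>2 - 2" using quartic d0 by (simp add: zero_le_mult_iff)
  \<comment> \<open>\<open>5915/10000\<close> is just below the positive root of the polynomial in \<open>q\<close>.\<close>
  have t: "5915/10000 \<le> t"
  proof (rule ccontr)
    assume n: "\<not> ?thesis"
    then have "t ^ k \<le> (5915/10000) ^ k" for k using t0 by (intro power_mono) auto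
    from this[of 2] this[of 3] this[of 4] q show False by (simp add: power_numeral_reduce)
  qed
  \<comment> \<open>The Cauchy inequality for \<open>(sqrt 2 t, 1)\<close> and \<open>(sqrt 2 t\<^sub>1, 1)\<close>, where \<open>t\<^sub>1 = 5915/10000\<close> and
    \<open>767/1000 \<le> 1 / sqrt(2 t\<^sub>1\<^sup>2 + 1)\<close>.\<close>
  have "767/1000 * (1183/1000 * t + 1) \<le> sqrt (2 * t\<^sup>2 + 1)"
  proof (rule real_le_rsqrt)
    have "0 \<le> 588289/500000 * (t - 5915/10000)\<^sup>2 + 118015679/2000000000000 * (2 * t\<^sup>2 + 1)" by simp
    also have "\<dots> = 2 * t\<^sup>2 + 1 - (767/1000 * (1183/1000 * t + 1))\<^sup>2"
      by (simp add: power2_eq_square field_simps)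
    finally show "(767/1000 * (1183/1000 * t + 1))\<^sup>2 \<le> 2 * t\<^sup>2 + 1" by simp
  qed
  then have "t * (767/1000 * (1183/1000 * t + 1)) \<le> t * sqrt (2 * t\<^sup>2 + 1)"
    using t0 by (rule mult_left_mono)
  moreover have "t * sqrt (2 * t\<^sup>2 + 1) * d\<^sup>2 \<le> u"
  proof -
    have "(2 * c\<^sup>2 + d\<^sup>2) * c\<^sup>2 = (t * d\<^sup>2)\<^sup>2 * (2 * t\<^sup>2 + 1)"
      by (simp add: c power2_eq_square algebra_simps)
    then have "t * sqrt (2 * t\<^sup>2 + 1) * d\<^sup>2 = sqrt ((2 * c\<^sup>2 + d\<^sup>2) * c\<^sup>2)"
      using t0 by (simp add: real_sqrt_mult)
    also have "\<dots> \<le> u" unfolding u_def using nn by (intro real_sqrt_le_mono mult_left_mono) auto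
    finally show ?thesis .
  qed
  ultimately have "t * (767/1000 * (1183/1000 * t + 1)) * d\<^sup>2 \<le> u"
    using d by (meson order_trans mult_right_mono less_imp_le)
  then have "t * (767/1000 * (1183/1000 * t + 1)) * d\<^sup>2 + 837/800 * (c\<^sup>2 + d\<^sup>2) < 2 * c * d + d\<^sup>2"
    using u nn(3) by argo
  then have "0 < (2 * t + 1 - 837/800 * (t\<^sup>2 + 1) - t * (767/1000 * (1183/1000 * t + 1))) * d\<^sup>2"
    by (simp add: c power2_eq_square field_simps)
  then have "0 < 2 * t + 1 - 837/800 * (t\<^sup>2 + 1) - t * (767/1000 * (1183/1000 * t + 1))"
    using d by (simp add: zero_less_mult_iff)
  \<comment> \<open>Replaces \<open>t^2\<close> by its tangent at 5915/10000; the concave quadratic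
    is negative and decreasing there, hence negative for all larger \<open>t\<close>.\<close>
  moreover have "0 \<le> (t - 5915/10000)\<^sup>2" by simp
  ultimately show False using t by (simp add: power2_eq_square field_simps)
qed

section \<open>Reduced density matrices of CSX-states\<close>

lemma sum_bitstrings5_01:
  fixes f :: "nat list \<Rightarrow> 'a::comm_monoid_add"
  assumes "i \<in> {0, 1}" "j \<in> {0, 1}"
  shows "(\<Sum>s\<in>{s \<in> bitstrings 5. s ! 0 = i \<and> s ! 1 = j}. f s) =
    (\<Sum>x\<in>{0, 1}. \<Sum>y\<in>{0, 1}. \<Sum>z\<in>{0, 1}. f [i, j, x, y, z])"
proof -
  have "{s \<in> bitstrings 5. s ! 0 = i \<and> s ! 1 = j} =
      (\<lambda>(x, y, z). [i, j, x, y, z]) ` ({0, 1} \<times> {0, 1} \<times> {0, 1})" (is "?L = ?R")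
  proof
    show "?L \<subseteq> ?R"
    proof
      fix s assume "s \<in> ?L"
      then have "s \<in> bitstrings 5" and ij: "s ! 0 = i" "s ! 1 = j" by simp_all
      then obtain b0 b1 b2 b3 b4 where s: "s = [b0, b1, b2, b3, b4]"
        and b: "b1 \<in> {0, 1}" "b2 \<in> {0, 1}" "b3 \<in> {0, 1}" "b4 \<in> {0, 1}"
        unfolding bitstrings5 by blast
      have "s = (\<lambda>(x, y, z). [i, j, x, y, z]) (b2, b3, b4)" using ij by (simp add: s numeral_2_eq_2)
      then show "s \<in> ?R" by (rule image_eqI) (intro SigmaI b)
    qed
    show "?R \<subseteq> ?L" using assms by (simp add: image_subset_iff bitstrings_def)
  qed
  moreover have "inj (\<lambda>(x, y, z). [i, j, x, y, z])" by (auto simp: inj_on_def)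
  ultimately show ?thesis
    by (simp only: sum.reindex inj_on_subset[OF _ subset_UNIV] sum.cartesian_product comp_def case_prod_unfold fst_conv snd_conv)
qed

lemma sum_bitstrings5_02:
  fixes f :: "nat list \<Rightarrow> 'a::comm_monoid_add"
  assumes "i \<in> {0, 1}" "j \<in> {0, 1}"
  shows "(\<Sum>s\<in>{s \<in> bitstrings 5. s ! 0 = i \<and> s ! 2 = j}. f s) =
    (\<Sum>x\<in>{0, 1}. \<Sum>y\<in>{0, 1}. \<Sum>z\<in>{0, 1}. f [i, x, j, y, z])"
proof -
  have "{s \<in> bitstrings 5. s ! 0 = i \<and> s ! 2 = j} =
      (\<lambda>(x, y, z). [i, x, j, y, z]) ` ({0, 1} \<times> {0, 1} \<times> {0, 1})" (is "?L = ?R")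
  proof
    show "?L \<subseteq> ?R"
    proof
      fix s assume "s \<in> ?L"
      then have "s \<in> bitstrings 5" and ij: "s ! 0 = i" "s ! 2 = j" by simp_all
      then obtain b0 b1 b2 b3 b4 where s: "s = [b0, b1, b2, b3, b4]"
        and b: "b1 \<in> {0, 1}" "b2 \<in> {0, 1}" "b3 \<in> {0, 1}" "b4 \<in> {0, 1}"
        unfolding bitstrings5 by blast
      have "s = (\<lambda>(x, y, z). [i, x, j, y, z]) (b1, b3, b4)" using ij by (simp add: s numeral_2_eq_2)
      then show "s \<in> ?R" by (rule image_eqI) (intro SigmaI b)
    qed
    show "?R \<subseteq> ?L" using assms by (simp add: image_subset_iff bitstrings_def)
  qed
  moreover have "inj (\<lambda>(x, y, z). [i, x, j, y, z])" by (auto simp: inj_on_def)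
  ultimately show ?thesis
    by (simp only: sum.reindex inj_on_subset[OF _ subset_UNIV] sum.cartesian_product comp_def case_prod_unfold fst_conv snd_conv)
qed

text \<open>Common form of both reduced states, with \<open>1 / sqrt 5\<close> absorbed into
  \<open>c\<close>, \<open>d\<close>, \<open>g\<close>. Here \<open>c\<close> belongs to the orbit
  whose two ones lie at the distance considered, \<open>d\<close> to the other orbit of weight
  two.\<close>

definition csx5_reduced :: "complex \<Rightarrow> complex \<Rightarrow> complex \<Rightarrow> complex \<Rightarrow> complex mat" where
  "csx5_reduced a c d g = x_mat
     (a * cnj a + 2 * (c * cnj c) + d * cnj d) (c * cnj c + 2 * (d * cnj d) + g * cnj g)
     (c * cnj c + 2 * (d * cnj d) + g * cnj g) (c * cnj c + 3 * (g * cnj g))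
     (a * cnj c + (2 * c + d) * cnj g) (c * cnj d + d * cnj c + d * cnj d + g * cnj g)
     (c * cnj d + d * cnj c + d * cnj d + g * cnj g) (c * cnj a + g * (2 * cnj c + cnj d))"

lemma csx5_amplitudes:
  "csx5 a c d g [0,0,0,0,0] = a"
  "csx5 a c d g [0,0,0,1,1] = c / complex_of_real (sqrt 5)"
  "csx5 a c d g [0,0,1,1,0] = c / complex_of_real (sqrt 5)"
  "csx5 a c d g [0,1,1,0,0] = c / complex_of_real (sqrt 5)"
  "csx5 a c d g [1,1,0,0,0] = c / complex_of_real (sqrt 5)"
  "csx5 a c d g [1,0,0,0,1] = c / complex_of_real (sqrt 5)"
  "csx5 a c d g [0,0,1,0,1] = d / complex_of_real (sqrt 5)"
  "csx5 a c d g [0,1,0,1,0] = d / complex_of_real (sqrt 5)"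
  "csx5 a c d g [1,0,1,0,0] = d / complex_of_real (sqrt 5)"
  "csx5 a c d g [0,1,0,0,1] = d / complex_of_real (sqrt 5)"
  "csx5 a c d g [1,0,0,1,0] = d / complex_of_real (sqrt 5)"
  "csx5 a c d g [0,1,1,1,1] = g / complex_of_real (sqrt 5)"
  "csx5 a c d g [1,1,1,1,0] = g / complex_of_real (sqrt 5)"
  "csx5 a c d g [1,1,1,0,1] = g / complex_of_real (sqrt 5)"
  "csx5 a c d g [1,1,0,1,1] = g / complex_of_real (sqrt 5)"
  "csx5 a c d g [1,0,1,1,1] = g / complex_of_real (sqrt 5)"
  by (simp_all add: csx5_values)

lemma reduced2_csx5_1:
  fixes a c d g :: complex
  defines "r \<equiv> complex_of_real (sqrt 5)"
  shows "reduced2 5 (csx5 a c d g) 0 1 = csx5_reduced a (c / r) (d / r) (g / r)"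
proof (rule mat_4_eqI)
  show "reduced2 5 (csx5 a c d g) 0 1 $$ (i, j) = csx5_reduced a (c / r) (d / r) (g / r) $$ (i, j)"
    if "i \<in> {0, 1, 2, 3}" "j \<in> {0, 1, 2, 3}" for i j
  proof -
    define c' d' g' where "c' = c / r" and "d' = d / r" and "g' = g / r"
    have upd: "[p, q, x, y, z][0 := p', 1 := q'] = [p', q', x, y, z]" for p q p' q' x y z :: nat
      by (simp add: numeral_2_eq_2)
    note amp = csx5_amplitudes[of a c d g, folded r_def, folded c'_def d'_def g'_def, unfolded One_nat_def]
    have "i div 2 \<in> {0, 1}" "i mod 2 \<in> {0, 1}" "i < 4" "j < 4" using that by auto
    then have "reduced2 5 (csx5 a c d g) 0 1 $$ (i, j) =
        (\<Sum>x\<in>{0, 1}. \<Sum>y\<in>{0, 1}. \<Sum>z\<in>{0, 1}. csx5 a c d g [i div 2, i mod 2, x, y, z] *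
           cnj (csx5 a c d g [j div 2, j mod 2, x, y, z]))"
      by (simp only: reduced2_def sum_bitstrings5_01 index_mat case_prod_conv upd)
    \<comment> \<open>Of the eight terms of the partial trace, those with an odd number of ones
      vanish; the others are read off from \<open>amp\<close>.\<close>
    also have "\<dots> = csx5_reduced a c' d' g' $$ (i, j)"
      using that unfolding csx5_reduced_def
      by (elim insertE emptyE; simp add: x_mat_def mat_of_rows_list_def;
          (simp add: amp)?; (simp add: csx5_even)?; (simp add: algebra_simps)?)
    finally show ?thesis by (simp only: c'_def d'_def g'_def)
  qed
qed (simp_all add: reduced2_def csx5_reduced_def)

lemma reduced2_csx5_2:
  fixes a c d g :: complex
  defines "r \<equiv> complex_of_real (sqrt 5)"
  shows "reduced2 5 (csx5 a c d g) 0 2 = csx5_reduced a (d / r) (c / r) (g / r)"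
proof (rule mat_4_eqI)
  show "reduced2 5 (csx5 a c d g) 0 2 $$ (i, j) = csx5_reduced a (d / r) (c / r) (g / r) $$ (i, j)"
    if "i \<in> {0, 1, 2, 3}" "j \<in> {0, 1, 2, 3}" for i j
  proof -
    define c' d' g' where "c' = c / r" and "d' = d / r" and "g' = g / r"
    have upd: "[p, x, q, y, z][0 := p', 2 := q'] = [p', x, q', y, z]" for p q p' q' x y z :: nat
      by (simp add: numeral_2_eq_2)
    note amp = csx5_amplitudes[of a c d g, folded r_def, folded c'_def d'_def g'_def, unfolded One_nat_def]
    have "i div 2 \<in> {0, 1}" "i mod 2 \<in> {0, 1}" "i < 4" "j < 4" using that by auto
    then have "reduced2 5 (csx5 a c d g) 0 2 $$ (i, j) =
        (\<Sum>x\<in>{0, 1}. \<Sum>y\<in>{0, 1}. \<Sum>z\<in>{0, 1}. csx5 a c d g [i div 2, x, i mod 2, y, z] *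
           cnj (csx5 a c d g [j div 2, x, j mod 2, y, z]))"
      by (simp only: reduced2_def sum_bitstrings5_02 index_mat case_prod_conv upd)
    also have "\<dots> = csx5_reduced a d' c' g' $$ (i, j)"
      using that unfolding csx5_reduced_def
      by (elim insertE emptyE; simp add: x_mat_def mat_of_rows_list_def;
          (simp add: amp)?; (simp add: csx5_even)?; (simp add: algebra_simps)?)
    finally show ?thesis by (simp only: c'_def d'_def g'_def)
  qed
qed (simp_all add: reduced2_def csx5_reduced_def)

section \<open>Subconcurrences as functions of the amplitudes\<close>

definition csx5_sC :: "complex \<Rightarrow> complex \<Rightarrow> complex \<Rightarrow> complex \<Rightarrow> real" where
  "csx5_sC a c d g = 2 * max
     (cmod (a * cnj c + (2 * c + d) * cnj g) - ((cmod c)\<^sup>2 + 2 * (cmod d)\<^sup>2 + (cmod g)\<^sup>2))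
     (cmod (c * cnj d + d * cnj c + d * cnj d + g * cnj g)
       - sqrt (((cmod a)\<^sup>2 + 2 * (cmod c)\<^sup>2 + (cmod d)\<^sup>2) * ((cmod c)\<^sup>2 + 3 * (cmod g)\<^sup>2)))"

text \<open>The triangle inequality, an equality for nonnegative real amplitudes, reduces the upper
  bound to moduli.\<close>

lemma cmod_corner_le:
  "cmod (a * cnj c + (2 * c + d) * cnj g) \<le> cmod a * cmod c + (2 * cmod c + cmod d) * cmod g"
proof -
  have "cmod (2 * c + d) * cmod g \<le> (2 * cmod c + cmod d) * cmod g"
    using norm_triangle_ineq[of "2 * c" d] by (intro mult_right_mono) (simp_all add: norm_mult)
  then show ?thesis
    using norm_triangle_ineq[of "a * cnj c" "(2 * c + d) * cnj g"] by (simp add: norm_mult)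
qed

lemma cmod_inner_le:
  "cmod (c * cnj d + d * cnj c + d * cnj d + g * cnj g) \<le> 2 * cmod c * cmod d + (cmod d)\<^sup>2 + (cmod g)\<^sup>2"
  using norm_triangle_ineq[of "c * cnj d + d * cnj c + d * cnj d" "g * cnj g"]
    norm_triangle_ineq[of "c * cnj d + d * cnj c" "d * cnj d"] norm_triangle_ineq[of "c * cnj d" "d * cnj c"]
  by (simp add: norm_mult power2_eq_square)

lemma subconcurrence_csx5_reduced: "subconcurrence (csx5_reduced a c d g) = csx5_sC a c d g"
proof -
  define z where "z = a * cnj c + (2 * c + d) * cnj g"
  define w where "w = c * cnj d + d * cnj c + d * cnj d + g * cnj g"
  define p where "p = (cmod a)\<^sup>2 + 2 * (cmod c)\<^sup>2 + (cmod d)\<^sup>2"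
  define q where "q = (cmod c)\<^sup>2 + 2 * (cmod d)\<^sup>2 + (cmod g)\<^sup>2"
  define r where "r = (cmod c)\<^sup>2 + 3 * (cmod g)\<^sup>2"
  have eq: "csx5_reduced a c d g = x_mat (of_real p) (of_real q) (of_real q) (of_real r) z w (cnj w) (cnj z)"
    unfolding csx5_reduced_def p_def q_def r_def z_def w_def
    by (simp only: of_real_add of_real_mult of_real_numeral complex_norm_square) (simp add: ac_simps)
  \<comment> \<open>Cauchy-Schwarz for \<open>(\<bar>a\<bar>, \<bar>c\<bar>, \<bar>c\<bar>, \<bar>d\<bar>)\<close> and \<open>(\<bar>c\<bar>, \<bar>g\<bar>, \<bar>g\<bar>, \<bar>g\<bar>)\<close>, by Lagrange's identity.\<close>
  have "cmod z \<le> sqrt (p * r)"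
  proof (rule real_le_rsqrt)
    let ?A = "cmod a" and ?C = "cmod c" and ?D = "cmod d" and ?G = "cmod g"
    have "(cmod z)\<^sup>2 \<le> (?A * ?C + (2 * ?C + ?D) * ?G)\<^sup>2"
      unfolding z_def by (rule power_mono[OF cmod_corner_le]) simp
    also have "\<dots> \<le> (?A * ?C + (2 * ?C + ?D) * ?G)\<^sup>2
      + 2 * (?A * ?G - ?C * ?C)\<^sup>2 + (?A * ?G - ?D * ?C)\<^sup>2 + 2 * (?C * ?G - ?D * ?G)\<^sup>2"
      by simp
    also have "\<dots> = p * r"
      unfolding p_def r_def by (simp add: power2_eq_square algebra_simps)
    finally show "(cmod z)\<^sup>2 \<le> p * r" .
  qed
  moreover have "cmod w \<le> q"
  proof -
    have "0 \<le> (cmod c - cmod d)\<^sup>2" by simp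
    then have "2 * cmod c * cmod d \<le> (cmod c)\<^sup>2 + (cmod d)\<^sup>2"
      by (simp add: power2_eq_square algebra_simps)
    then show ?thesis using cmod_inner_le[of c d g] unfolding w_def q_def by argo
  qed
  moreover have "0 \<le> p" "0 \<le> r" by (simp_all add: p_def r_def)
  ultimately show ?thesis
    unfolding eq csx5_sC_def by (subst subconcurrence_x_mat) (simp_all add: p_def q_def r_def z_def w_def)
qed

lemma sC5_csx5:
  fixes a c d g :: complex
  defines "r \<equiv> complex_of_real (sqrt 5)"
  shows "sC5 1 (csx5 a c d g) = csx5_sC a (c / r) (d / r) (g / r)"
    and "sC5 2 (csx5 a c d g) = csx5_sC a (d / r) (c / r) (g / r)"
  by (simp_all only: sC5_def reduced2_csx5_1 reduced2_csx5_2 subconcurrence_csx5_reduced r_def)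

text \<open>Exchanging \<open>c\<close> and \<open>d\<close> makes the hypothesis a statement about
  the other distance: its corner or its inner term is nonnegative. Either case bounds the inner
  term; the corner term is bounded by \<open>corner_bound\<close>.\<close>

lemma csx5_sC_bound:
  assumes "0 \<le> csx5_sC a d c g"
  shows "csx5_sC a c d g \<le> 837/2000 * ((cmod a)\<^sup>2 + 5 * ((cmod c)\<^sup>2 + (cmod d)\<^sup>2 + (cmod g)\<^sup>2))"
proof -
  let ?A = "cmod a" and ?C = "cmod c" and ?D = "cmod d" and ?G = "cmod g"
  let ?N = "837/4000 * (?A\<^sup>2 + 5 * (?C\<^sup>2 + ?D\<^sup>2 + ?G\<^sup>2))"
  have "?A * ?C + (2 * ?C + ?D) * ?G - (?C\<^sup>2 + 2 * ?D\<^sup>2 + ?G\<^sup>2) \<le> ?N"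
    by (rule corner_bound)
  then have F: "cmod (a * cnj c + (2 * c + d) * cnj g) - (?C\<^sup>2 + 2 * ?D\<^sup>2 + ?G\<^sup>2) \<le> ?N"
    using cmod_corner_le[of a c d g] by argo
  consider
      "?D\<^sup>2 + 2 * ?C\<^sup>2 + ?G\<^sup>2 \<le> cmod (a * cnj d + (2 * d + c) * cnj g)"
    | "sqrt ((?A\<^sup>2 + 2 * ?D\<^sup>2 + ?C\<^sup>2) * (?D\<^sup>2 + 3 * ?G\<^sup>2))
        \<le> cmod (d * cnj c + c * cnj d + c * cnj c + g * cnj g)"
    using assms unfolding csx5_sC_def by (auto simp: max_def split: if_splits)
  then have "2 * ?C * ?D + ?D\<^sup>2 + ?G\<^sup>2 - sqrt ((?A\<^sup>2 + 2 * ?C\<^sup>2 + ?D\<^sup>2) * (?C\<^sup>2 + 3 * ?G\<^sup>2)) \<le> ?N"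
  proof cases
    case 1
    then show ?thesis using cmod_corner_le[of a d c g]
      by (intro inner_bound_if_corner_nonneg) auto
  next
    case 2
    then show ?thesis using cmod_inner_le[of d c g]
      by (intro inner_bound_if_inner_nonneg) (auto simp: ac_simps)
  qed
  then have "cmod (c * cnj d + d * cnj c + d * cnj d + g * cnj g)
      - sqrt ((?A\<^sup>2 + 2 * ?C\<^sup>2 + ?D\<^sup>2) * (?C\<^sup>2 + 3 * ?G\<^sup>2)) \<le> ?N"
    using cmod_inner_le[of c d g] by argo
  from max.boundedI[OF F this] show ?thesis unfolding csx5_sC_def by argo
qed

section \<open>Numerical bounds and the common threshold\<close>

lemma sC5_1_bound:
  assumes "\<psi> \<in> CSX5" "0 \<le> sC5 2 \<psi>"
  shows "sC5 1 \<psi> \<le> 837/2000"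
proof -
  obtain a c d g where \<psi>: "\<psi> = csx5 a c d g"
    and n: "(cmod a)\<^sup>2 + (cmod c)\<^sup>2 + (cmod d)\<^sup>2 + (cmod g)\<^sup>2 = 1"
    using assms(1) by (auto simp: CSX5_def)
  have "5 * (cmod (x / complex_of_real (sqrt 5)))\<^sup>2 = (cmod x)\<^sup>2" for x
    by (simp add: norm_divide power_divide)
  then show ?thesis
    using csx5_sC_bound[OF assms(2)[unfolded \<psi> sC5_csx5]] n
    unfolding \<psi> sC5_csx5 distrib_left by simp
qed

text \<open>The value 835/2000 = 0.4175 is the lower end of the tolerance, matching 837/2000 in
  \<open>sC5_1_bound\<close>.\<close>

lemma sC5_witness: "\<exists>\<psi>\<in>CSX5. 0 \<le> sC5 2 \<psi> \<and> 835/2000 \<le> sC5 1 \<psi>"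
proof
  \<comment> \<open>The rational point of the unit circle with parameter \<open>137/500\<close>; the ratio \<open>c/d \<approx> 0.59248\<close> is just above
    the extremal one.\<close>
  define c d :: real where "c = 137000/268769" and "d = 231231/268769"
  let ?\<psi> = "csx5 0 (of_real c) (of_real d) 0"
  show "?\<psi> \<in> CSX5"
    unfolding CSX5_def mem_Collect_eq
    by (rule exI[of _ 0], rule exI[of _ "of_real c"], rule exI[of _ "of_real d"], rule exI[of _ 0])
      (simp add: c_def d_def power2_eq_square)
  have inner: "2 * (cmod (u * cnj v + v * cnj u + v * cnj v)
       - sqrt ((2 * (cmod u)\<^sup>2 + (cmod v)\<^sup>2) * (cmod u)\<^sup>2)) \<le> csx5_sC 0 u v 0" for u v
    unfolding csx5_sC_def by (intro mult_left_mono max.coboundedI2) simp_all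
  have s: "csx5_sC 0 (of_real x / complex_of_real (sqrt 5)) (of_real y / complex_of_real (sqrt 5)) 0
     \<ge> 2 / 5 * (2 * x * y + y\<^sup>2 - sqrt ((2 * x\<^sup>2 + y\<^sup>2) * x\<^sup>2))" if "0 \<le> x" "0 \<le> y" for x y :: real
  proof -
    let ?x = "of_real x / complex_of_real (sqrt 5)" and ?y = "of_real y / complex_of_real (sqrt 5)"
    have "?x * cnj ?y + ?y * cnj ?x + ?y * cnj ?y = complex_of_real ((2 * x * y + y\<^sup>2) / 5)"
      by (simp add: power2_eq_square field_simps flip: of_real_mult) (simp add: mult_ac)
    then have "cmod (?x * cnj ?y + ?y * cnj ?x + ?y * cnj ?y) = (2 * x * y + y\<^sup>2) / 5"
      using that by (simp only: norm_of_real) simp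
    moreover have "sqrt ((2 * (cmod ?x)\<^sup>2 + (cmod ?y)\<^sup>2) * (cmod ?x)\<^sup>2) = sqrt ((2 * x\<^sup>2 + y\<^sup>2) * x\<^sup>2) / 5"
    proof -
      have "(2 * (cmod ?x)\<^sup>2 + (cmod ?y)\<^sup>2) * (cmod ?x)\<^sup>2 = (2 * x\<^sup>2 + y\<^sup>2) * x\<^sup>2 / 5\<^sup>2"
        by (simp add: norm_divide power_divide field_simps)
      then show ?thesis by (simp only: real_sqrt_divide real_sqrt_abs abs_numeral)
    qed
    ultimately show ?thesis using inner[of ?x ?y] by argo
  qed
  have "sqrt ((2 * d\<^sup>2 + c\<^sup>2) * d\<^sup>2) \<le> 2 * d * c + c\<^sup>2"
    by (rule real_le_lsqrt) (simp_all add: c_def d_def power2_eq_square)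
  \<comment> \<open>The factor 5/2 undoes the 2/5 in \<open>s\<close>, which is the 2 of
    \<open>csx5_sC\<close> times the square of \<open>1 / sqrt 5\<close>.\<close>
  moreover have "sqrt ((2 * c\<^sup>2 + d\<^sup>2) * c\<^sup>2) \<le> 2 * c * d + d\<^sup>2 - 5/2 * (835/2000)"
    by (rule real_le_lsqrt) (simp_all add: c_def d_def power2_eq_square)
  ultimately show "0 \<le> sC5 2 ?\<psi> \<and> 835/2000 \<le> sC5 1 ?\<psi>"
    using s[of c d] s[of d c] unfolding sC5_csx5 by (auto simp: c_def d_def)
qed

lemma sC5_swap:
  assumes "\<psi> \<in> CSX5"
  obtains \<phi> where "\<phi> \<in> CSX5" "sC5 1 \<phi> = sC5 2 \<psi>" "sC5 2 \<phi> = sC5 1 \<psi>"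
proof -
  obtain a c d g where \<psi>: "\<psi> = csx5 a c d g"
    and n: "(cmod a)\<^sup>2 + (cmod c)\<^sup>2 + (cmod d)\<^sup>2 + (cmod g)\<^sup>2 = 1"
    using assms by (auto simp: CSX5_def)
  have "csx5 a d c g \<in> CSX5" unfolding CSX5_def using n by (force simp: ac_simps)
  then show ?thesis by (rule that) (simp_all only: \<psi> sC5_csx5)
qed

theorem mainTheorem6:
  shows "\<exists>\<tau>::real. \<bar>\<tau> - 0.418\<bar> \<le> 0.0005 \<and>
    (\<forall>(j, k) \<in> {(1, 2), (2, 1)}.
       (\<forall>\<psi>\<in>CSX5. sC5 j \<psi> > \<tau> \<longrightarrow> sC5 k \<psi> < 0 \<and> C5 k \<psi> = 0) \<and>
       (\<forall>t::real. (\<forall>\<psi>\<in>CSX5. sC5 j \<psi> > t \<longrightarrow> sC5 k \<psi> < 0) \<longrightarrow> \<tau> \<le> t))"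
proof -
  define S where "S = sC5 1 ` {\<psi> \<in> CSX5. 0 \<le> sC5 2 \<psi>}"
  have bdd: "bdd_above S" using sC5_1_bound unfolding S_def by (intro bdd_aboveI[of _ "837/2000"]) auto
  obtain \<omega> where \<omega>: "\<omega> \<in> CSX5" "0 \<le> sC5 2 \<omega>" "835/2000 \<le> sC5 1 \<omega>" using sC5_witness by blast
  have S: "S \<noteq> {}" using \<omega> by (auto simp: S_def)
  have "835/2000 \<le> Sup S" using \<omega> bdd by (intro cSup_upper2[of "sC5 1 \<omega>"]) (auto simp: S_def)
  moreover have "Sup S \<le> 837/2000" using S sC5_1_bound unfolding S_def by (intro cSup_least) auto
  ultimately have approx: "\<bar>Sup S - 0.418\<bar> \<le> 0.0005" unfolding abs_le_iff by simp
  have C5: "C5 k \<psi> = 0" if "sC5 k \<psi> < 0" for k \<psi>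
    using that by (simp add: C5_def sC5_def concurrence_def)
  have 1: "sC5 2 \<psi> < 0" if "\<psi> \<in> CSX5" "Sup S < sC5 1 \<psi>" for \<psi>
  proof (rule ccontr)
    assume "\<not> ?thesis"
    then have "sC5 1 \<psi> \<in> S" using that by (auto simp: S_def)
    then show False using cSup_upper[OF _ bdd] that by force
  qed
  have 2: "sC5 1 \<psi> < 0" if "\<psi> \<in> CSX5" "Sup S < sC5 2 \<psi>" for \<psi>
    using sC5_swap[OF that(1)] 1 that(2) by metis
  \<comment> \<open>By contraposition every admissible \<open>t\<close> is an upper bound of
    \<open>S\<close>.\<close>
  have 3: "Sup S \<le> t" if t: "\<And>\<psi>. \<psi> \<in> CSX5 \<Longrightarrow> t < sC5 1 \<psi> \<Longrightarrow> sC5 2 \<psi> < 0" for t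
    using S t unfolding S_def by (intro cSup_least) force+
  \<comment> \<open>The exchange of amplitudes makes a \<open>t\<close> admissible for (2,1)
    admissible for (1,2).\<close>
  have 4: "Sup S \<le> t" if t: "\<And>\<psi>. \<psi> \<in> CSX5 \<Longrightarrow> t < sC5 2 \<psi> \<Longrightarrow> sC5 1 \<psi> < 0" for t
    using sC5_swap t by (intro 3) metis
  show ?thesis
    by (rule exI[of _ "Sup S"]) (use approx 1 2 3 4 C5 in auto)
qed

end
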